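(* Let $(T,d)$ be a metric space with $D(T)<\infty$ and $m$ a Borel probability measure on $T$ with $\operatorname{supp}(m)=T$. Let $a,b\ge0$, $\varphi\in\mathcal{G}_{a,b}$, $R\ge2$, and let $k_0\in\mathbb{Z}$ be the integer with $R^{k_0}\le\varphi^{-1}(1)<R^{k_0+1}$. Set $r_{k_0}(x):=D(T)$ for $x\in T$, and for integers $k>k_0$ and $x\in T$ set $$r_k(x):=\min\left\{\varepsilon\ge0:\varphi^{-1}\left(\frac{1}{m(B(x,\varepsilon))}\right)\le R^k\right\}.$$ Then for every integer $k\ge k_0$ the function $r_k:T\to\mathbb{R}$ is $1$-Lipschitz.
   Context: $B(x,\varepsilon)=\{y\in T:d(x,y)\le\varepsilon\}$ is the closed ball and $D(T)=\sup\{d(s,t):s,t\in T\}$ the diameter of $T$. For $a,b\ge0$, $\mathcal{G}_{a,b}$ is the class of all functions $\varphi:\mathbb{R}_+\to\mathbb{R}$ that are (strictly) increasing and continuous, satisfy $\varphi(0)=0$, and satisfy $x\le a+b\frac{\varphi(xy)}{\varphi(y)}$ for all $x\ge 0$, $y\ge\varphi^{-1}(1)$; it is understood that the inverse $\varphi^{-1}$ is defined on $[0,\infty)$. In the definition of $r_k$, values of $\varepsilon$ with $m(B(x,\varepsilon))=0$ (possible only for $\varepsilon=0$) are regarded as giving $\varphi^{-1}(1/0)=+\infty$. *)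

theory Defs
  imports "HOL-Probability.Probability"
begin

definition measure_support :: "'a::topological_space measure \<Rightarrow> 'a set" where
  "measure_support m = {x. \<forall>U. open U \<and> x \<in> U \<longrightarrow> emeasure m U > 0}"

text \<open>A function on the half-line is a total function on the reals of which only the
  values on \<open>{0..}\<close> matter.\<close>

definition inv_nonneg :: "(real \<Rightarrow> real) \<Rightarrow> real \<Rightarrow> real" where
  "inv_nonneg \<phi> = inv_into {0..} \<phi>"

text \<open>The condition \<open>\<phi> ` {0..} = {0..}\<close> says that the inverse of \<open>\<phi>\<close> is defined on all
  of \<open>{0..}\<close>.\<close>

definition G_class :: "real \<Rightarrow> real \<Rightarrow> (real \<Rightarrow> real) set" where
  "G_class a b = {\<phi>.
     strict_mono_on {0..} \<phi> \<and> continuous_on {0..} \<phi> \<and> \<phi> 0 = 0 \<and> \<phi> ` {0..} = {0..} \<and>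
     (\<forall>x y. x \<ge> 0 \<and> y \<ge> inv_nonneg \<phi> 1 \<longrightarrow> x \<le> a + b * (\<phi> (x * y) / \<phi> y))}"

text \<open>A ball of measure zero counts as \<open>\<phi>\<^sup>-\<^sup>1(1/0) = \<infinity>\<close>, so such a radius is not admissible;
  the explicit condition is needed because \<open>1 / 0 = 0\<close> in HOL.\<close>

definition admissible_radii ::
  "'a::metric_space measure \<Rightarrow> (real \<Rightarrow> real) \<Rightarrow> real \<Rightarrow> int \<Rightarrow> 'a \<Rightarrow> real set" where
  "admissible_radii m \<phi> R k x =
     {\<epsilon>. \<epsilon> \<ge> 0 \<and> measure m (cball x \<epsilon>) \<noteq> 0 \<and>
          inv_nonneg \<phi> (1 / measure m (cball x \<epsilon>)) \<le> R powi k}"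

text \<open>Only \<open>k \<ge> k0\<close> is meaningful. The minimum is rendered by \<open>LEAST\<close>, since \<open>Min\<close> is
  for finite sets.\<close>

definition radius ::
  "'a::metric_space measure \<Rightarrow> (real \<Rightarrow> real) \<Rightarrow> real \<Rightarrow> int \<Rightarrow> int \<Rightarrow> 'a \<Rightarrow> real" where
  "radius m \<phi> R k0 k x =
     (if k = k0 then diameter (UNIV :: 'a set)
      else (LEAST \<epsilon>. \<epsilon> \<in> admissible_radii m \<phi> R k x))"

end

theory Submission
  imports Defs
begin

text \<open>For \<open>k > k0\<close> the radius \<open>r\<^sub>k x\<close> is the least \<open>\<epsilon>\<close> for which the ball around \<open>x\<close> has measure
  at least \<open>1 / \<phi> (R\<^sup>k)\<close>, and \<open>1 / \<phi> (R\<^sup>k) \<le> 1\<close>. The minimum is attained since \<open>m\<close> is continuous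
  from above along shrinking closed balls. If \<open>\<epsilon>\<close> is admissible at \<open>y\<close>, then \<open>\<epsilon> + d x y\<close> is
  admissible at \<open>x\<close>, because the ball around \<open>x\<close> of that radius contains the one around \<open>y\<close>.\<close>

lemma measure_cball_mono:
  fixes x y :: "'a::metric_space"
  assumes "finite_measure m" "sets m = sets borel" "\<epsilon> + dist x y \<le> \<delta>"
  shows "measure m (cball y \<epsilon>) \<le> measure m (cball x \<delta>)"
proof -
  interpret finite_measure m by fact
  have "cball y \<epsilon> \<subseteq> cball x \<delta>"
  proof
    fix z assume "z \<in> cball y \<epsilon>"
    then show "z \<in> cball x \<delta>"
      using assms(3) dist_triangle[of x z y] by simp
  qed
  then show ?thesis
    using assms(2) by (intro finite_measure_mono) auto
qed

lemma cball_eq_INT_cball: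
  fixes x :: "'a::metric_space"
  shows "cball x r = (\<Inter>n. cball x (r + 1 / real (Suc n)))"
proof (intro equalityI subsetI)
  fix z assume "z \<in> cball x r"
  moreover have "r \<le> r + 1 / real (Suc n)" for n by simp
  ultimately show "z \<in> (\<Inter>n. cball x (r + 1 / real (Suc n)))"
    by (fastforce intro: order_trans)
next
  fix z assume z: "z \<in> (\<Inter>n. cball x (r + 1 / real (Suc n)))"
  have "(\<lambda>n. r + 1 / real (Suc n)) \<longlonglongrightarrow> r + 0"
    by (intro tendsto_intros LIMSEQ_Suc lim_1_over_n)
  then have "dist x z \<le> r + 0"
    by (rule LIMSEQ_le_const) (use z in auto)
  then show "z \<in> cball x r" by simp
qed

lemma measure_cball_ge_Inf:
  fixes x :: "'a::metric_space"
  assumes fin: "finite_measure m" and sets: "sets m = sets borel"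
    and S: "S = {\<epsilon>. 0 \<le> \<epsilon> \<and> c \<le> measure m (cball x \<epsilon>)}" and ne: "S \<noteq> {}"
  shows "Inf S \<in> S"
proof -
  interpret finite_measure m by fact
  have bdd: "bdd_below S"
    unfolding S by (intro bdd_belowI[of _ 0]) auto
  have ge: "c \<le> measure m (cball x (Inf S + 1 / real (Suc n)))" for n
  proof -
    have "Inf S < Inf S + 1 / real (Suc n)" by simp
    then obtain \<epsilon> where \<epsilon>: "\<epsilon> \<in> S" "\<epsilon> < Inf S + 1 / real (Suc n)"
      using cInf_less_iff[OF ne bdd] by blast
    have "c \<le> measure m (cball x \<epsilon>)"
      using \<epsilon>(1) unfolding S by simp
    also have "\<dots> \<le> measure m (cball x (Inf S + 1 / real (Suc n)))"
      using \<epsilon>(2) by (intro measure_cball_mono[OF fin sets]) simp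
    finally show ?thesis .
  qed
  have "(\<lambda>n. measure m (cball x (Inf S + 1 / real (Suc n))))
      \<longlonglongrightarrow> measure m (\<Inter>n. cball x (Inf S + 1 / real (Suc n)))"
  proof (rule finite_Lim_measure_decseq)
    show "range (\<lambda>n. cball x (Inf S + 1 / real (Suc n))) \<subseteq> sets m"
      unfolding sets by auto
    show "decseq (\<lambda>n. cball x (Inf S + 1 / real (Suc n)))"
      unfolding decseq_def by (intro allI impI subset_cball) (simp add: frac_le)
  qed
  then have "c \<le> measure m (cball x (Inf S))"
    unfolding cball_eq_INT_cball[of x "Inf S", symmetric]
    by (rule LIMSEQ_le_const) (use ge in blast)
  moreover have "0 \<le> Inf S"
    using ne by (rule cInf_greatest) (simp add: S)
  ultimately show ?thesis
    unfolding S by simp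
qed

lemma Least_cball_lipschitz:
  fixes m :: "'a::metric_space measure"
  assumes fin: "finite_measure m" and sets: "sets m = sets borel"
    and S: "\<And>x. S x = {\<epsilon>. 0 \<le> \<epsilon> \<and> c \<le> measure m (cball x \<epsilon>)}"
    and ne: "\<And>x. S x \<noteq> {}"
  shows "1-lipschitz_on UNIV (\<lambda>x. LEAST \<epsilon>. \<epsilon> \<in> S x)"
proof -
  have bdd: "bdd_below (S x)" for x
    unfolding S by (intro bdd_belowI[of _ 0]) auto
  have mem: "Inf (S x) \<in> S x" for x
    by (rule measure_cball_ge_Inf[OF fin sets S ne])
  have Least: "(LEAST \<epsilon>. \<epsilon> \<in> S x) = Inf (S x)" for x
    by (intro Least_equality mem cInf_lower bdd)
  have le: "Inf (S x) \<le> Inf (S y) + dist x y" for x y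
  proof (rule cInf_lower[OF _ bdd])
    have "measure m (cball y (Inf (S y))) \<le> measure m (cball x (Inf (S y) + dist x y))"
      by (rule measure_cball_mono[OF fin sets]) simp
    then show "Inf (S y) + dist x y \<in> S x"
      using mem[of y] unfolding S by auto
  qed
  show ?thesis
    unfolding Least
  proof (rule lipschitz_onI)
    fix x y
    show "dist (Inf (S x)) (Inf (S y)) \<le> 1 * dist x y"
      using le[of x y] le[of y x] by (simp add: dist_real_def dist_commute)
  qed simp
qed

lemma inv_nonneg_le_iff:
  assumes "\<phi> \<in> G_class a b" "0 \<le> u" "0 \<le> v"
  shows "inv_nonneg \<phi> u \<le> v \<longleftrightarrow> u \<le> \<phi> v"
proof -
  have mono: "strict_mono_on {0..} \<phi>" and u: "u \<in> \<phi> ` {0..}"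
    using assms(1,2) by (auto simp: G_class_def)
  have "inv_nonneg \<phi> u \<in> {0..}" "\<phi> (inv_nonneg \<phi> u) = u"
    unfolding inv_nonneg_def by (rule inv_into_into[OF u], rule f_inv_into_f[OF u])
  then show ?thesis
    using strict_mono_on_less_eq[OF mono, of "inv_nonneg \<phi> u" v] assms(3) by simp
qed

lemma admissible_radii_eq:
  assumes "\<phi> \<in> G_class a b" "0 \<le> R" "0 < \<phi> (R powi k)"
  shows "admissible_radii m \<phi> R k x = {\<epsilon>. 0 \<le> \<epsilon> \<and> 1 / \<phi> (R powi k) \<le> measure m (cball x \<epsilon>)}"
proof -
  have "(p \<noteq> 0 \<and> inv_nonneg \<phi> (1 / p) \<le> R powi k) \<longleftrightarrow> 1 / \<phi> (R powi k) \<le> p"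
    if "0 \<le> p" for p
  proof (cases "p = 0")
    case False
    with that assms(3) show ?thesis
      using inv_nonneg_le_iff[OF assms(1), of "1 / p" "R powi k"] assms(2)
      by (simp add: field_simps)
  qed (use assms(3) in \<open>simp add: not_le\<close>)
  then show ?thesis
    unfolding admissible_radii_def by simp
qed

theorem lemma2p1:
  fixes m :: "'a::metric_space measure"
    and \<phi> :: "real \<Rightarrow> real"
    and a b R :: real
    and k0 k :: int
  assumes "bounded (UNIV :: 'a set)"
    and "prob_space m"
    and "sets m = sets borel"
    and "measure_support m = UNIV"
    and "a \<ge> 0" and "b \<ge> 0"
    and "\<phi> \<in> G_class a b"
    and "R \<ge> 2"
    and "R powi k0 \<le> inv_nonneg \<phi> 1"
    and "inv_nonneg \<phi> 1 < R powi (k0 + 1)"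
    and "k \<ge> k0"
  shows "1-lipschitz_on UNIV (radius m \<phi> R k0 k)"
proof (cases "k = k0")
  case True
  then show ?thesis
    by (auto simp: radius_def intro: lipschitz_onI)
next
  case False
  interpret prob_space m by fact
  have "R powi (k0 + 1) \<le> R powi k"
    using False assms(8,11) by (intro power_int_increasing) auto
  then have ge1: "1 \<le> \<phi> (R powi k)"
    using inv_nonneg_le_iff[OF assms(7), of 1 "R powi k"] assms(8,10) by simp
  have S: "admissible_radii m \<phi> R k x =
      {\<epsilon>. 0 \<le> \<epsilon> \<and> 1 / \<phi> (R powi k) \<le> measure m (cball x \<epsilon>)}" for x
    by (rule admissible_radii_eq[OF assms(7)]) (use ge1 assms(8) in auto)
  have ne: "admissible_radii m \<phi> R k x \<noteq> {}" for x
  proof -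
    have "cball x (diameter (UNIV :: 'a set)) = space m"
      using diameter_bounded_bound[OF assms(1), of x] sets_eq_imp_space_eq[OF assms(3)] by auto
    then have "measure m (cball x (diameter (UNIV :: 'a set))) = 1"
      using prob_space by simp
    then have "diameter (UNIV :: 'a set) \<in> admissible_radii m \<phi> R k x"
      unfolding S using diameter_ge_0[OF assms(1)] ge1 by simp
    then show ?thesis by blast
  qed
  have "radius m \<phi> R k0 k = (\<lambda>x. LEAST \<epsilon>. \<epsilon> \<in> admissible_radii m \<phi> R k x)"
    using False by (simp add: radius_def fun_eq_iff)
  then show ?thesis
    using Least_cball_lipschitz[OF finite_measure_axioms assms(3) S ne] by simp
qed

end
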